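(* Let $R$ be a unital alternative ring which is $2$-torsion free and $3$-torsion free, let $e_1\in R$ be a nontrivial idempotent, put $e_2=1-e_1$ and $R_{ij}=e_iRe_j$ ($i,j\in\{1,2\}$), and assume that $R$ satisfies: (1) for $i\neq j$ and $x_{ij}\in R_{ij}$, if $x_{ij}R_{ji}=0$ then $x_{ij}=0$; (2) for $x_{11}\in R_{11}$, if $x_{11}R_{12}=0$ or $R_{21}x_{11}=0$ then $x_{11}=0$; (3) for $x_{22}\in R_{22}$, if $R_{12}x_{22}=0$ or $x_{22}R_{21}=0$ then $x_{22}=0$; (4) if $z\in\mathcal{Z}(R)$ and $z\neq 0$ then $zR=R$. Let $D\colon R\to R$ be a Lie multiplicative derivation. Then $D$ is of the form $D=\delta+\tau$, where $\delta\colon R\to R$ is an additive derivation of $R$ and $\tau\colon R\to\mathcal{Z}(R)$ is a map with $\tau([x,y])=0$ for all $x,y\in R$, if and only if a) $e_2D(R_{11})e_2\subseteq\mathcal{Z}(R)e_2$, and b) $e_1D(R_{22})e_1\subseteq\mathcal{Z}(R)e_1$.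
   Context: Rings are not assumed associative or commutative. The associator is $(x,y,z)=(xy)z-x(yz)$ and $[x,y]=xy-yx$. A ring $R$ is alternative if $(x,x,y)=0=(y,x,x)$ for all $x,y\in R$. It is $k$-torsion free if $kx=0$ implies $x=0$. The nucleus is $\mathcal{N}(R)=\{r\in R: (x,y,r)=(x,r,y)=(r,x,y)=0\ \forall x,y\in R\}$ and the centre is $\mathcal{Z}(R)=\{r\in\mathcal{N}(R): [r,x]=0\ \forall x\in R\}$. A nontrivial idempotent is a nonzero element $e_1$ with $e_1e_1=e_1$ and $e_1\neq 1$. In an alternative ring $(e_ia)e_j=e_i(ae_j)$, so $e_iae_j$ is unambiguous, and $R=R_{11}\oplus R_{12}\oplus R_{21}\oplus R_{22}$ (Peirce decomposition). A Lie multiplicative derivation is a map $D\colon R\to R$ (not assumed additive) such that $D([x,y])=[D(x),y]+[x,D(y)]$ for all $x,y\in R$. An additive derivation is an additive map $\delta$ with $\delta(xy)=\delta(x)y+x\delta(y)$ for all $x,y\in R$. *)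

theory Defs
  imports Complex_Main
begin

text \<open>
  The ring \<open>R\<close> is the whole type \<open>'a\<close>. The algebraic classes of the library that carry both
  distributive laws also carry associativity of multiplication, hence the separate hierarchy below.
\<close>

class nonassoc_ring = ab_group_add + times +
  assumes nonassoc_distrib_left: "x * (y + z) = x * y + x * z"
    and nonassoc_distrib_right: "(x + y) * z = x * z + y * z"
begin

definition associator :: "'a \<Rightarrow> 'a \<Rightarrow> 'a \<Rightarrow> 'a" where
  "associator x y z = (x * y) * z - x * (y * z)"

definition commutator :: "'a \<Rightarrow> 'a \<Rightarrow> 'a" where
  "commutator x y = x * y - y * x"

definition nucleus :: "'a set" where
  "nucleus = {r. \<forall>x y. associator x y r = 0 \<and> associator x r y = 0 \<and> associator r x y = 0}"

definition centre :: "'a set" where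
  "centre = {r \<in> nucleus. \<forall>x. commutator r x = 0}"

text \<open>
  The set \<open>e R f\<close>. In an alternative ring with \<open>e\<close> idempotent and \<open>f \<in> {e, 1 - e}\<close> the
  bracketing is immaterial.
\<close>

definition peirce :: "'a \<Rightarrow> 'a \<Rightarrow> 'a set" where
  "peirce e f = {(e * a) * f | a. True}"

definition lie_multiplicative_derivation :: "('a \<Rightarrow> 'a) \<Rightarrow> bool" where
  "lie_multiplicative_derivation D \<longleftrightarrow>
     (\<forall>x y. D (commutator x y) = commutator (D x) y + commutator x (D y))"

definition additive_derivation :: "('a \<Rightarrow> 'a) \<Rightarrow> bool" where
  "additive_derivation \<delta> \<longleftrightarrow>
     (\<forall>x y. \<delta> (x + y) = \<delta> x + \<delta> y) \<and> (\<forall>x y. \<delta> (x * y) = \<delta> x * y + x * \<delta> y)"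

end

class alternative_ring = nonassoc_ring +
  assumes left_alternative: "associator x x y = 0"
    and right_alternative: "associator y x x = 0"

class unital_alternative_ring = alternative_ring + one +
  assumes nonassoc_mult_1_left: "1 * x = x"
    and nonassoc_mult_1_right: "x * 1 = x"

text \<open>
  The \<open>k\<close>-fold multiple of \<open>x\<close> is written as a sum of \<open>k\<close> copies of \<open>x\<close>.
\<close>

definition torsion_free :: "nat \<Rightarrow> 'a::ab_group_add itself \<Rightarrow> bool" where
  "torsion_free k R \<longleftrightarrow> (\<forall>x::'a. (\<Sum>i<k. x) = 0 \<longrightarrow> x = 0)"

definition nontrivial_idempotent :: "'a::unital_alternative_ring \<Rightarrow> bool" where
  "nontrivial_idempotent e \<longleftrightarrow> e \<noteq> 0 \<and> e * e = e \<and> e \<noteq> 1"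

end

theory Submission
  imports Defs
begin

text \<open>
  Write \<open>e = e\<^sub>1\<close>. For \<open>y \<in> R\<^sub>1\<^sub>2 + R\<^sub>2\<^sub>1\<close> the inner derivation \<open>c \<mapsto> [[e,y],c] - 3(e,y,c)\<close> maps
  \<open>e\<close> to \<open>-y\<close>, so one may assume that \<open>D e\<close> is diagonal; then \<open>D\<close> preserves \<open>R\<^sub>1\<^sub>2\<close> and \<open>R\<^sub>2\<^sub>1\<close>
  and \<open>D e\<close> is central.

  The defect \<open>w(x,y) = D(x + y) - D x - D y\<close> satisfies \<open>[w(x,y),t] = w([x,t],[y,t])\<close>, and
  \<open>w\<close> vanishes as soon as one argument is 0. For \<open>u \<in> R\<^sub>1\<^sub>2\<close>, \<open>v \<in> R\<^sub>2\<^sub>1\<close>, commutators with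
  elements of \<open>R\<^sub>1\<^sub>2\<close> and \<open>e\<close> show that the \<open>R\<^sub>2\<^sub>1\<close>-part \<open>q\<close> of \<open>w(u,v)\<close> has \<open>[q,y]\<close> central for
  all \<open>y \<in> R\<^sub>1\<^sub>2\<close>; as \<open>[q,y]\<close> anticommutes with \<open>y\<close> and nonzero central elements are invertible,
  \<open>[q,y] = 0\<close>, whence \<open>q = 0\<close>. Together with \<open>[e + x, f + y] = x + y + [x,y]\<close> on \<open>R\<^sub>1\<^sub>2\<close> this
  makes \<open>D\<close> additive on \<open>R\<^sub>1\<^sub>2 + R\<^sub>2\<^sub>1\<close>, and then additive modulo the centre everywhere.
  Conditions a) and b) allow \<open>D\<close> to be corrected by central elements to an additive map that
  preserves every Peirce component, and such a map is a derivation.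
\<close>

section \<open>Alternative rings and their inner derivations\<close>

lemma nonassoc_zero_left [simp]: "0 * x = (0::'a::nonassoc_ring)"
  using nonassoc_distrib_right[of 0 0 x] by simp

lemma nonassoc_zero_right [simp]: "x * 0 = (0::'a::nonassoc_ring)"
  using nonassoc_distrib_left[of x 0 0] by simp

lemma nonassoc_minus_left [simp]: "(- x) * y = - (x * y)" for x :: "'a::nonassoc_ring"
  using nonassoc_distrib_right[of "- x" x y] by (simp add: eq_neg_iff_add_eq_0)

lemma nonassoc_minus_right [simp]: "x * (- y) = - (x * y)" for x :: "'a::nonassoc_ring"
  using nonassoc_distrib_left[of x "- y" y] by (simp add: eq_neg_iff_add_eq_0)

lemma nonassoc_diff_left: "(x - y) * z = x * z - y * z" for x :: "'a::nonassoc_ring"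
  using nonassoc_distrib_right[of x "- y" z] by simp

lemma nonassoc_diff_right: "x * (y - z) = x * y - x * z" for x :: "'a::nonassoc_ring"
  using nonassoc_distrib_left[of x y "- z"] by simp

lemmas nonassoc_simps = nonassoc_distrib_left nonassoc_distrib_right
  nonassoc_diff_left nonassoc_diff_right

lemmas commutator_expand = commutator_def nonassoc_simps algebra_simps

lemma commutator_add_left: "commutator (x + y) z = commutator x z + commutator y z"
  by (simp add: commutator_expand)

lemma commutator_add_right: "commutator x (y + z) = commutator x y + commutator x z"
  by (simp add: commutator_expand)

lemma commutator_diff_left: "commutator (x - y) z = commutator x z - commutator y z"
  by (simp add: commutator_expand)

lemma commutator_diff_right: "commutator x (y - z) = commutator x y - commutator x z"
  by (simp add: commutator_expand)

lemma commutator_minus_left: "commutator (- x) y = - commutator x y"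
  by (simp add: commutator_expand)

lemma commutator_minus_right: "commutator x (- y) = - commutator x y"
  by (simp add: commutator_expand)

lemma commutator_zero [simp]: "commutator 0 x = 0" "commutator x 0 = 0" "commutator x x = 0"
  by (simp_all add: commutator_def)

lemma commutator_swap: "commutator x y = - commutator y x"
  by (simp add: commutator_def)

lemmas commutator_linear = commutator_add_left commutator_add_right commutator_diff_left
  commutator_diff_right commutator_minus_left commutator_minus_right

lemma associator_add:
  "associator (x + x') y z = associator x y z + associator x' y z"
  "associator x (y + y') z = associator x y z + associator x y' z"
  "associator x y (z + z') = associator x y z + associator x y z'"
  by (simp_all add: associator_def nonassoc_simps)

lemma associator_diff:
  "associator (x - x') y z = associator x y z - associator x' y z"
  "associator x (y - y') z = associator x y z - associator x y' z"
  "associator x y (z - z') = associator x y z - associator x y z'"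
  by (simp_all add: associator_def nonassoc_simps)

lemma associator_swap12: "associator y x z = - associator x y z"
  for x :: "'a::alternative_ring"
proof -
  have "associator (x + y) (x + y) z = 0" by (rule left_alternative)
  then show ?thesis
    unfolding associator_add by (simp add: left_alternative eq_neg_iff_add_eq_0 add.commute)
qed

lemma associator_swap23: "associator x z y = - associator x y z"
  for x :: "'a::alternative_ring"
proof -
  have "associator x (y + z) (y + z) = 0" by (rule right_alternative)
  then show ?thesis
    unfolding associator_add by (simp add: right_alternative eq_neg_iff_add_eq_0 add.commute)
qed

lemma associator_rotate: "associator y z x = associator x y z"
  for x :: "'a::alternative_ring"
  by (metis associator_swap12 associator_swap23)

lemma flexible: "(x * y) * x = x * (y * x)" for x :: "'a::alternative_ring"
  using associator_swap23[of x y x] left_alternative[of x y] by (simp add: associator_def)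

lemma left_alternative_mult: "x * (x * y) = (x * x) * y" for x :: "'a::alternative_ring"
  using left_alternative[of x y] by (simp add: associator_def)

lemma right_alternative_mult: "(y * x) * x = y * (x * x)" for x :: "'a::alternative_ring"
  using right_alternative[of y x] by (simp add: associator_def)

text \<open>By skew symmetry, one associative ordering of a triple makes the others associative;
  \<open>peirce_assoc\<close> picks an ordering in which both bracketings are zero.\<close>

lemma assoc_swap23: "(x * y) * z = x * (y * z)"
  if "(x * z) * y = x * (z * y)" for x :: "'a::alternative_ring"
  using that associator_swap23[of x y z] by (simp add: associator_def)

lemma assoc_swap12: "(x * y) * z = x * (y * z)"
  if "(y * x) * z = y * (x * z)" for x :: "'a::alternative_ring"
  using that associator_swap12[of x y z] by (simp add: associator_def)

text \<open>In any ring the left side is (x,y,z) - (x,z,y) + (z,x,y), and skew symmetry turns each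
  term into (x,y,z).\<close>

lemma commutator_mult:
  "commutator (x * y) z - x * commutator y z - commutator x z * y =
     associator x y z + associator x y z + associator x y z" for x :: "'a::alternative_ring"
proof -
  have "commutator (x * y) z - x * commutator y z - commutator x z * y =
      associator x y z - associator x z y + associator z x y"
    by (simp add: associator_def commutator_expand)
  then show ?thesis
    using associator_swap23[of x z y] associator_rotate[of x y z] by simp
qed

text \<open>The Teichmueller identity of an arbitrary ring, rewritten by skew symmetry.\<close>

lemma teichmueller:
  "associator (w * x) y z + associator (y * z) w x - associator (x * y) z w
     - w * associator x y z - associator w x y * z = 0" for w :: "'a::alternative_ring"
proof -
  have "associator (w * x) y z - associator w (x * y) z + associator w x (y * z)
     - w * associator x y z - associator w x y * z = 0"
    by (simp add: associator_def nonassoc_simps)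
  then show ?thesis
    using associator_rotate[of "x * y" z w] associator_rotate[of w x "y * z"]
    by (simp add: algebra_simps)
qed

lemma associator_mult:
  "associator a b (x * y) - x * associator a b y - associator a b x * y
     + associator x y (commutator a b) = 0" for a :: "'a::alternative_ring"
proof -
  have "associator a b (x * y) - x * associator a b y - associator a b x * y
     + associator x y (commutator a b) =
     associator (x * y) a b - x * associator y a b - associator x a b * y
     + associator (a * b) x y - associator (b * a) x y"
    by (simp add: commutator_def associator_diff associator_rotate[of a b]
        associator_rotate[of x y "a * b"] associator_rotate[of x y "b * a"])
  \<comment> \<open>Each bracket is an instance of \<open>teichmueller\<close>. The first two yield
    the associators of \<open>a * b\<close> and \<open>b * a\<close>; the other three cancel the
    surplus terms up to skew symmetry.\<close>
  also have "\<dots> =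
     (associator (x * y) a b + associator (a * b) x y - associator (y * a) b x
        - x * associator y a b - associator x y a * b)
   - (associator (x * y) b a + associator (b * a) x y - associator (y * b) a x
        - x * associator y b a - associator x y b * a)
   + (associator (x * a) y b + associator (y * b) x a - associator (a * y) b x
        - x * associator a y b - associator x a y * b)
   + (associator (b * x) y a + associator (y * a) b x - associator (x * y) a b
        - b * associator x y a - associator b x y * a)
   + (associator (b * x) a y + associator (a * y) b x - associator (x * a) y b
        - b * associator x a y - associator b x a * y)"
    by (simp add: associator_swap23[of "x * y" b a] associator_swap23[of "y * b" x a]
        associator_swap23[of y b a] associator_swap12[of a y b] associator_swap23[of x a y]
        associator_swap23[of "b * x" a y] associator_rotate[of x y b, symmetric]
        associator_rotate[of x a b, symmetric])
  also have "\<dots> = 0" unfolding teichmueller by simp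
  finally show ?thesis .
qed

text \<open>In an alternative ring the commutator with \<open>commutator a b\<close> need not be a
  derivation; three associators correct it.\<close>

definition inner_derivation :: "'a::alternative_ring \<Rightarrow> 'a \<Rightarrow> 'a \<Rightarrow> 'a" where
  "inner_derivation a b c =
     commutator (commutator a b) c - (associator a b c + associator a b c + associator a b c)"

text \<open>The product rule fails by 3(x,y,[a,b]) for the commutator with [a,b], and by
  -(x,y,[a,b]) for c \<mapsto> (a,b,c), so subtracting three copies of the latter needs both signs
  to match: \<open>P\<close> and \<open>Q\<close> record exactly these two identities.\<close>

lemma additive_derivation_inner: "additive_derivation (inner_derivation a b)"
  unfolding additive_derivation_def
proof (intro conjI allI)
  show "inner_derivation a b (x + y) = inner_derivation a b x + inner_derivation a b y" for x y
    by (simp add: inner_derivation_def commutator_linear associator_add)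
  show "inner_derivation a b (x * y) = inner_derivation a b x * y + x * inner_derivation a b y"
    for x y
  proof -
    let ?s = "commutator a b"
    define P where "P = associator a b (x * y) - x * associator a b y - associator a b x * y
      + associator x y ?s"
    define Q where "Q = commutator (x * y) ?s - x * commutator y ?s - commutator x ?s * y -
      (associator x y ?s + associator x y ?s + associator x y ?s)"
    have "inner_derivation a b (x * y) - (inner_derivation a b x * y + x * inner_derivation a b y)
        = - (P + P + P) - Q"
      unfolding inner_derivation_def P_def Q_def
        commutator_swap[of "x * y" ?s] commutator_swap[of x ?s] commutator_swap[of y ?s]
      by (simp add: nonassoc_simps)
    also have "\<dots> = 0"
      unfolding P_def Q_def associator_mult commutator_mult by simp
    finally show ?thesis by simp
  qed
qed

text \<open>If \<open>t\<close> commutes with everything, \<open>commutator_mult\<close> leaves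
  3(x,y,t) = 0, so \<open>t\<close> is also nuclear.\<close>

lemma centreI:
  fixes t :: "'a::alternative_ring"
  assumes three: "\<And>x::'a. x + x + x = 0 \<Longrightarrow> x = 0" and t: "\<And>x. commutator t x = 0"
  shows "t \<in> centre"
proof -
  have t': "commutator x t = 0" for x using t[of x] commutator_swap[of x t] by simp
  have assoc: "associator x y t = 0" for x y
    using commutator_mult[of x y t] t' by - (rule three, simp)
  moreover have "associator x t y = 0" "associator t x y = 0" for x y
    using assoc associator_swap23[of x t y] associator_rotate[of x y t] by simp_all
  ultimately show ?thesis
    using t by (simp add: centre_def nucleus_def)
qed

lemma centre_commutator: "commutator z x = 0" "commutator x z = 0" if "z \<in> centre"
  using that commutator_swap[of x z] by (simp_all add: centre_def)

lemma centre_comm: "z * x = x * z" if "z \<in> centre"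
  using centre_commutator[OF that, of x] by (simp add: commutator_def)

lemma centre_assoc:
  assumes "z \<in> centre"
  shows "(z * x) * y = z * (x * y)" "(x * z) * y = x * (z * y)" "(x * y) * z = x * (y * z)"
  using assms by (simp_all add: centre_def nucleus_def associator_def)

lemma centre_0 [simp]: "0 \<in> centre"
  by (simp add: centre_def nucleus_def associator_def commutator_def)

lemma centre_add: "x + y \<in> centre" if "x \<in> centre" "y \<in> centre"
  using that by (simp add: centre_def nucleus_def associator_add commutator_linear)

lemma centre_diff: "x - y \<in> centre" if "x \<in> centre" "y \<in> centre"
  using that by (simp add: centre_def nucleus_def associator_diff commutator_linear)

section \<open>Peirce decomposition\<close>

text \<open>The complement \<open>f\<close> is a parameter, so that \<open>e\<close> and
  \<open>f\<close> can be exchanged (\<open>swap\<close>) and each result on \<open>R12\<close> also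
  yields one on \<open>R21\<close>.\<close>

locale peirce_pair =
  fixes e f :: "'a::unital_alternative_ring"
  assumes two_torsion_free: "\<And>x::'a. x + x = 0 \<Longrightarrow> x = 0"
    and idem: "e * e = e" and sum_1: "e + f = 1"
begin

lemma f_eq: "f = 1 - e"
  using sum_1 by (simp add: eq_diff_eq add.commute)

lemma f_mult: "f * x = x - e * x" "x * f = x - x * e"
  by (simp_all add: f_eq nonassoc_simps nonassoc_mult_1_left nonassoc_mult_1_right)

lemma swap: "peirce_pair f e"
proof
  show "x + x = 0 \<Longrightarrow> x = 0" for x :: 'a by (rule two_torsion_free)
  have "f * e = 0" by (simp add: f_mult idem)
  then show "f * f = f" by (simp add: f_mult(2))
  show "f + e = 1" using sum_1 by (simp add: add.commute)
qed

abbreviation "R11 \<equiv> peirce e e"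
abbreviation "R12 \<equiv> peirce e f"
abbreviation "R21 \<equiv> peirce f e"
abbreviation "R22 \<equiv> peirce f f"

lemma e_mult_e_mult [simp]: "e * (e * x) = e * x" "(x * e) * e = x * e"
  by (simp_all add: left_alternative_mult right_alternative_mult idem)

lemma e_mult_flexible: "(e * x) * e = e * (x * e)"
  by (rule flexible)

lemma mem_R11: "x \<in> R11 \<longleftrightarrow> e * x = x \<and> x * e = x"
  by (auto simp: peirce_def e_mult_flexible) metis

lemma mem_R12: "x \<in> R12 \<longleftrightarrow> e * x = x \<and> x * e = 0"
proof
  assume "e * x = x \<and> x * e = 0"
  then have "x = (e * x) * f" by (simp add: f_mult)
  then show "x \<in> R12" unfolding peirce_def by blast
qed (auto simp: peirce_def f_mult nonassoc_simps e_mult_flexible)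

lemma mem_R21: "x \<in> R21 \<longleftrightarrow> e * x = 0 \<and> x * e = x"
proof
  assume "e * x = 0 \<and> x * e = x"
  then have "x = (f * x) * e" by (simp add: f_mult)
  then show "x \<in> R21" unfolding peirce_def by blast
qed (auto simp: peirce_def f_mult nonassoc_simps e_mult_flexible)

lemma mem_R22: "x \<in> R22 \<longleftrightarrow> e * x = 0 \<and> x * e = 0"
proof
  assume "e * x = 0 \<and> x * e = 0"
  then have "x = (f * x) * f" by (simp add: f_mult)
  then show "x \<in> R22" unfolding peirce_def by blast
qed (auto simp: peirce_def f_mult nonassoc_simps e_mult_flexible)

lemmas mem_peirce = mem_R11 mem_R12 mem_R21 mem_R22

lemma peirce_eigen:
  "x \<in> R11 \<Longrightarrow> e * x = x" "x \<in> R11 \<Longrightarrow> x * e = x" "x \<in> R11 \<Longrightarrow> f * x = 0" "x \<in> R11 \<Longrightarrow> x * f = 0"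
  "x \<in> R12 \<Longrightarrow> e * x = x" "x \<in> R12 \<Longrightarrow> x * e = 0" "x \<in> R12 \<Longrightarrow> f * x = 0" "x \<in> R12 \<Longrightarrow> x * f = x"
  "x \<in> R21 \<Longrightarrow> e * x = 0" "x \<in> R21 \<Longrightarrow> x * e = x" "x \<in> R21 \<Longrightarrow> f * x = x" "x \<in> R21 \<Longrightarrow> x * f = 0"
  "x \<in> R22 \<Longrightarrow> e * x = 0" "x \<in> R22 \<Longrightarrow> x * e = 0" "x \<in> R22 \<Longrightarrow> f * x = x" "x \<in> R22 \<Longrightarrow> x * f = x"
  by (simp_all add: mem_peirce f_mult)

lemma f_mem: "f \<in> R22"
  using f_mult[of e] f_mult[of f] by (simp add: mem_peirce idem)

lemma peirce_subgroup:
  assumes "a \<in> {e, f}" "b \<in> {e, f}"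
  shows "0 \<in> peirce a b" "x \<in> peirce a b \<Longrightarrow> y \<in> peirce a b \<Longrightarrow> x + y \<in> peirce a b"
    "x \<in> peirce a b \<Longrightarrow> y \<in> peirce a b \<Longrightarrow> x - y \<in> peirce a b"
    "x \<in> peirce a b \<Longrightarrow> - x \<in> peirce a b"
  using assms by (auto simp: mem_peirce nonassoc_simps)

lemmas R11_subgroup = peirce_subgroup[of e e, simplified]
lemmas R12_subgroup = peirce_subgroup[of e f, simplified]
lemmas R21_subgroup = peirce_subgroup[of f e, simplified]
lemmas R22_subgroup = peirce_subgroup[of f f, simplified]
lemmas Rij_subgroup = R11_subgroup R12_subgroup R21_subgroup R22_subgroup

lemma decompose: "x = (e * x) * e + (e * x) * f + (f * x) * e + (f * x) * f"
  by (simp add: f_mult nonassoc_simps)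

lemma component_mem: "(a * x) * b \<in> peirce a b"
  by (auto simp: peirce_def)

lemma decomposeE:
  obtains x11 x12 x21 x22 where "x11 \<in> R11" "x12 \<in> R12" "x21 \<in> R21" "x22 \<in> R22"
    "x = x11 + x12 + x21 + x22"
  using decompose[of x] component_mem by metis

lemma components:
  assumes "x11 \<in> R11" "x12 \<in> R12" "x21 \<in> R21" "x22 \<in> R22"
  shows "(e * (x11 + x12 + x21 + x22)) * e = x11" "(e * (x11 + x12 + x21 + x22)) * f = x12"
    "(f * (x11 + x12 + x21 + x22)) * e = x21" "(f * (x11 + x12 + x21 + x22)) * f = x22"
  using assms by (simp_all add: nonassoc_simps peirce_eigen)

lemma sum_zero:
  assumes "x11 + x12 + x21 + x22 = 0" "x11 \<in> R11" "x12 \<in> R12" "x21 \<in> R21" "x22 \<in> R22"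
  shows "x11 = 0" "x12 = 0" "x21 = 0" "x22 = 0"
  using components[OF assms(2-)] unfolding assms(1) by simp_all

text \<open>Skew symmetry of the associator expresses the action of \<open>e\<close> on a product
  through its action on the factors.\<close>

lemma e_mult_mult:
  "e * (x * y) = (e * x) * y + (x * e) * y - x * (e * y)"
  "(x * y) * e = x * (y * e) + x * (e * y) - (x * e) * y"
  using associator_swap12[of e x y] associator_swap23[of x y e]
  by (simp_all add: associator_def algebra_simps)

text \<open>Unlike in the associative case, products within \<open>R12\<close> or within
  \<open>R21\<close> need not vanish; they fall into the opposite component.\<close>

lemma mult_mem:
  "x \<in> R11 \<Longrightarrow> y \<in> R11 \<Longrightarrow> x * y \<in> R11" "x \<in> R11 \<Longrightarrow> y \<in> R12 \<Longrightarrow> x * y \<in> R12"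
  "x \<in> R12 \<Longrightarrow> y \<in> R12 \<Longrightarrow> x * y \<in> R21" "x \<in> R12 \<Longrightarrow> y \<in> R21 \<Longrightarrow> x * y \<in> R11"
  "x \<in> R12 \<Longrightarrow> y \<in> R22 \<Longrightarrow> x * y \<in> R12" "x \<in> R21 \<Longrightarrow> y \<in> R11 \<Longrightarrow> x * y \<in> R21"
  "x \<in> R21 \<Longrightarrow> y \<in> R12 \<Longrightarrow> x * y \<in> R22" "x \<in> R21 \<Longrightarrow> y \<in> R21 \<Longrightarrow> x * y \<in> R12"
  "x \<in> R22 \<Longrightarrow> y \<in> R21 \<Longrightarrow> x * y \<in> R21" "x \<in> R22 \<Longrightarrow> y \<in> R22 \<Longrightarrow> x * y \<in> R22"
  by (simp_all add: mem_peirce e_mult_mult)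

text \<open>By \<open>e_mult_mult\<close> each product is an eigenvector of a multiplication by
  \<open>e\<close> with eigenvalue 2 or -1. That multiplication is an idempotent map, so 2-torsion
  freeness leaves only zero.\<close>

lemma mult_zero:
  "x \<in> R11 \<Longrightarrow> y \<in> R21 \<Longrightarrow> x * y = 0" "x \<in> R11 \<Longrightarrow> y \<in> R22 \<Longrightarrow> x * y = 0"
  "x \<in> R12 \<Longrightarrow> y \<in> R11 \<Longrightarrow> x * y = 0" "x \<in> R21 \<Longrightarrow> y \<in> R22 \<Longrightarrow> x * y = 0"
  "x \<in> R22 \<Longrightarrow> y \<in> R11 \<Longrightarrow> x * y = 0" "x \<in> R22 \<Longrightarrow> y \<in> R12 \<Longrightarrow> x * y = 0"
proof -
  have left: "z = 0" if z: "e * z = z + z \<or> e * z = - z" for z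
  proof -
    have "e * z = z + z \<Longrightarrow> e * z = e * z + e * z" "e * z = - z \<Longrightarrow> e * z = - (e * z)"
      using e_mult_e_mult(1)[of z] by (metis nonassoc_distrib_left, metis nonassoc_minus_right)
    then show ?thesis using z two_torsion_free by (metis add.right_inverse add_cancel_left_right)
  qed
  have right: "z = 0" if z: "z * e = z + z \<or> z * e = - z" for z
  proof -
    have "z * e = z + z \<Longrightarrow> z * e = z * e + z * e" "z * e = - z \<Longrightarrow> z * e = - (z * e)"
      using e_mult_e_mult(2)[of z] by (metis nonassoc_distrib_right, metis nonassoc_minus_left)
    then show ?thesis using z two_torsion_free by (metis add.right_inverse add_cancel_left_right)
  qed
  show "x \<in> R11 \<Longrightarrow> y \<in> R21 \<Longrightarrow> x * y = 0" "x \<in> R11 \<Longrightarrow> y \<in> R22 \<Longrightarrow> x * y = 0"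
    by (rule left; simp add: mem_peirce e_mult_mult)+
  show "x \<in> R12 \<Longrightarrow> y \<in> R11 \<Longrightarrow> x * y = 0" "x \<in> R22 \<Longrightarrow> y \<in> R11 \<Longrightarrow> x * y = 0"
    by (rule right; simp add: mem_peirce e_mult_mult)+
  show "x \<in> R21 \<Longrightarrow> y \<in> R22 \<Longrightarrow> x * y = 0" by (rule right; simp add: mem_peirce e_mult_mult)
  show "x \<in> R22 \<Longrightarrow> y \<in> R12 \<Longrightarrow> x * y = 0" by (rule left; simp add: mem_peirce e_mult_mult)
qed

text \<open>The right alternative law gives \<open>e * (x * x) = x * x\<close>, while
  \<open>x * x\<close> lies in \<open>R21\<close>, which \<open>e\<close> annihilates from the
  left.\<close>

lemma square_zero: "x * x = 0" if "x \<in> R12"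
proof -
  have "e * (x * x) = x * x"
    using right_alternative_mult[of e x] that by (simp add: peirce_eigen)
  then show ?thesis using mult_mem(3)[OF that that] by (simp add: mem_R21)
qed

lemma commutator_e:
  "x \<in> R11 \<Longrightarrow> commutator x e = 0" "x \<in> R12 \<Longrightarrow> commutator x e = - x"
  "x \<in> R21 \<Longrightarrow> commutator x e = x" "x \<in> R22 \<Longrightarrow> commutator x e = 0"
  by (simp_all add: commutator_def peirce_eigen)

lemma commutator_f: "commutator x f = - commutator x e"
  by (simp add: commutator_def f_mult)

lemma commutator_e_offdiag: obtains u v where "u \<in> R12" "v \<in> R21" "commutator x e = u + v"
proof -
  obtain x11 x12 x21 x22 where x: "x11 \<in> R11" "x12 \<in> R12" "x21 \<in> R21" "x22 \<in> R22"
    "x = x11 + x12 + x21 + x22" by (rule decomposeE)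
  then show ?thesis
    using that[of "- x12" x21] by (simp add: commutator_linear commutator_e R12_subgroup)
qed

lemma diagonalE:
  assumes "commutator x e = 0"
  obtains x11 x22 where "x11 \<in> R11" "x22 \<in> R22" "x = x11 + x22"
proof -
  obtain x11 x12 x21 x22 where x: "x11 \<in> R11" "x12 \<in> R12" "x21 \<in> R21" "x22 \<in> R22"
    "x = x11 + x12 + x21 + x22" by (rule decomposeE)
  have "0 + - x12 + x21 + 0 = 0"
    using assms x by (simp add: commutator_linear commutator_e)
  then have "- x12 = 0" "x21 = 0"
    using sum_zero[of 0 "- x12" x21 0] x(2,3) by (simp_all add: Rij_subgroup)
  then show ?thesis using that x by simp
qed

lemma commutator_mem:
  "x \<in> R12 \<Longrightarrow> y \<in> R12 \<Longrightarrow> commutator x y \<in> R21"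
  "commutator a e = 0 \<Longrightarrow> y \<in> R12 \<Longrightarrow> commutator a y \<in> R12"
  "x \<in> R21 \<Longrightarrow> y \<in> R12 \<Longrightarrow> commutator (commutator x y) e = 0"
proof -
  show "x \<in> R12 \<Longrightarrow> y \<in> R12 \<Longrightarrow> commutator x y \<in> R21"
    by (simp add: commutator_def mult_mem Rij_subgroup)
  show "commutator a y \<in> R12" if diag: "commutator a e = 0" and y: "y \<in> R12"
  proof -
    obtain a1 a2 where "a1 \<in> R11" "a2 \<in> R22" "a = a1 + a2"
      by (rule diagonalE[OF diag])
    then show ?thesis
      using y by (simp add: commutator_def nonassoc_simps mult_zero mult_mem R12_subgroup)
  qed
  show "commutator (commutator x y) e = 0" if "x \<in> R21" "y \<in> R12"
    using that commutator_e(4)[OF mult_mem(7)[OF that]] commutator_e(1)[OF mult_mem(4)[OF that(2,1)]]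
    by (simp add: commutator_def[of x y] commutator_linear)
qed

text \<open>In each case a transposed triple has both bracketings zero by
  \<open>mult_zero\<close>.\<close>

lemma peirce_assoc:
  "x \<in> R11 \<Longrightarrow> y \<in> R11 \<Longrightarrow> z \<in> R12 \<Longrightarrow> (x * y) * z = x * (y * z)"
  "x \<in> R11 \<Longrightarrow> y \<in> R12 \<Longrightarrow> z \<in> R22 \<Longrightarrow> (x * y) * z = x * (y * z)"
  "x \<in> R21 \<Longrightarrow> y \<in> R11 \<Longrightarrow> z \<in> R12 \<Longrightarrow> (x * y) * z = x * (y * z)"
  "x \<in> R21 \<Longrightarrow> y \<in> R12 \<Longrightarrow> z \<in> R22 \<Longrightarrow> (x * y) * z = x * (y * z)"
  "x \<in> R12 \<Longrightarrow> y \<in> R22 \<Longrightarrow> z \<in> R22 \<Longrightarrow> (x * y) * z = x * (y * z)"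
  "x \<in> R22 \<Longrightarrow> y \<in> R21 \<Longrightarrow> z \<in> R12 \<Longrightarrow> (x * y) * z = x * (y * z)"
  by (rule assoc_swap23 assoc_swap12; simp add: mult_zero mult_mem)+

lemma anticommute: "y * x = - (x * y)" if "x \<in> R12" "y \<in> R12"
  using square_zero[OF R12_subgroup(2)[OF that]] square_zero that
  by (simp add: nonassoc_simps eq_neg_iff_add_eq_0 add.commute)

end

section \<open>Faithful Peirce components and the centre\<close>

locale faithful_peirce_pair = peirce_pair +
  assumes three_torsion_free: "\<And>x::'a. x + x + x = 0 \<Longrightarrow> x = 0"
    and R12_faithful: "\<And>x. x \<in> peirce e f \<Longrightarrow> (\<forall>y \<in> peirce f e. x * y = 0) \<Longrightarrow> x = 0"
    and R21_faithful: "\<And>x. x \<in> peirce f e \<Longrightarrow> (\<forall>y \<in> peirce e f. x * y = 0) \<Longrightarrow> x = 0"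
    and R11_faithful: "\<And>x. x \<in> peirce e e \<Longrightarrow>
           (\<forall>y \<in> peirce e f. x * y = 0) \<or> (\<forall>y \<in> peirce f e. y * x = 0) \<Longrightarrow> x = 0"
    and R22_faithful: "\<And>x. x \<in> peirce f f \<Longrightarrow>
           (\<forall>y \<in> peirce e f. y * x = 0) \<or> (\<forall>y \<in> peirce f e. x * y = 0) \<Longrightarrow> x = 0"
    and centre_surj: "\<And>z::'a. z \<in> centre \<Longrightarrow> z \<noteq> 0 \<Longrightarrow> range (\<lambda>x. z * x) = UNIV"
begin

lemma faithful_swap: "faithful_peirce_pair f e"
proof -
  interpret s: peirce_pair f e by (rule swap)
  show ?thesis
    by unfold_locales
      (fact three_torsion_free R12_faithful R21_faithful centre_surj
       | (erule R22_faithful R11_faithful, blast))+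
qed

text \<open>A nonzero central element divides 1, hence is invertible.\<close>

lemma centre_cancel: "x = 0" if z: "z \<in> centre" "z \<noteq> 0" "z * x = 0" for x z :: 'a
proof -
  obtain s where s: "1 = z * s" using centre_surj[OF z(1,2)] by blast
  have "x = (s * z) * x" using s centre_comm[OF z(1), of s] by (simp add: nonassoc_mult_1_left)
  also have "\<dots> = 0" using centre_assoc(2)[OF z(1), of s x] z(3) by simp
  finally show ?thesis .
qed

text \<open>Commuting with \<open>e\<close> makes \<open>t = z1 + z2\<close> diagonal, and commuting
  with \<open>R12\<close> means \<open>z1 * y = y * z2\<close>. Faithfulness carries this relation
  over to the other three components.\<close>

lemma centre_if_commutes_R12:
  assumes "commutator t e = 0" and R12: "\<And>y. y \<in> R12 \<Longrightarrow> commutator t y = 0"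
  shows "t \<in> centre"
proof -
  obtain z1 z2 where z: "z1 \<in> R11" "z2 \<in> R22" and t: "t = z1 + z2"
    by (rule diagonalE[OF assms(1)])
  have zy: "z1 * y = y * z2" if "y \<in> R12" for y
    using R12[OF that] that z by (simp add: t commutator_def nonassoc_simps mult_zero)
  have c1: "z1 * x = x * z1" if x: "x \<in> R11" for x
  proof -
    have "(z1 * x - x * z1) * y = 0" if y: "y \<in> R12" for y
    proof -
      have "(z1 * x) * y = z1 * (x * y)" "(x * z1) * y = x * (z1 * y)"
        "(x * y) * z2 = x * (y * z2)"
        using x y z by (simp_all add: peirce_assoc)
      then show ?thesis
        using zy[OF y] zy[OF mult_mem(2)[OF x y]] by (simp add: nonassoc_simps)
    qed
    then have "z1 * x - x * z1 = 0"
      using x z by (intro R11_faithful) (auto simp: mult_mem R11_subgroup)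
    then show ?thesis by simp
  qed
  have c2: "z2 * x = x * z2" if x: "x \<in> R22" for x
  proof -
    have "y * (z2 * x - x * z2) = 0" if y: "y \<in> R12" for y
    proof -
      have "(y * z2) * x = y * (z2 * x)" "(y * x) * z2 = y * (x * z2)"
        "(z1 * y) * x = z1 * (y * x)"
        using x y z by (simp_all add: peirce_assoc)
      then show ?thesis
        using zy[OF y] zy[OF mult_mem(5)[OF y x]] by (simp add: nonassoc_simps)
    qed
    then have "z2 * x - x * z2 = 0"
      using x z by (intro R22_faithful) (auto simp: mult_mem R22_subgroup)
    then show ?thesis by simp
  qed
  \<comment> \<open>After multiplication by \<open>x\<close>, both sides become
    \<open>(y * x) * z2\<close>, because \<open>z2\<close> commutes with \<open>y * x\<close> in
    \<open>R22\<close>.\<close>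
  have c3: "y * z1 = z2 * y" if y: "y \<in> R21" for y
  proof -
    have "(y * z1 - z2 * y) * x = 0" if x: "x \<in> R12" for x
    proof -
      have "(y * z1) * x = y * (z1 * x)" "(z2 * y) * x = z2 * (y * x)"
        "(y * x) * z2 = y * (x * z2)"
        using x y z by (simp_all add: peirce_assoc)
      then show ?thesis
        using zy[OF x] c2[OF mult_mem(7)[OF y x]] by (simp add: nonassoc_simps)
    qed
    then have "y * z1 - z2 * y = 0"
      using y z by (intro R21_faithful) (auto simp: mult_mem R21_subgroup)
    then show ?thesis by simp
  qed
  show ?thesis
  proof (rule centreI[OF three_torsion_free])
    fix x
    obtain x11 x12 x21 x22 where x: "x11 \<in> R11" "x12 \<in> R12" "x21 \<in> R21" "x22 \<in> R22"
      "x = x11 + x12 + x21 + x22" by (rule decomposeE)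
    then show "commutator t x = 0"
      using z zy[of x12] c1[of x11] c2[of x22] c3[of x21]
      by (simp add: t commutator_def nonassoc_simps mult_zero)
  qed auto
qed

text \<open>A central element of \<open>R11\<close> or \<open>R22\<close> annihilates
  \<open>R12\<close>, since one of the two orders of the product is always zero; in
  \<open>R12\<close> and \<open>R21\<close>, left and right multiplication by \<open>e\<close>
  differ.\<close>

lemma centre_inter_peirce:
  assumes "z \<in> centre" "z \<in> R11 \<or> z \<in> R12 \<or> z \<in> R21 \<or> z \<in> R22"
  shows "z = 0"
proof -
  have c: "z * x = x * z" for x using centre_comm[OF assms(1)] .
  consider "z \<in> R11" | "z \<in> R12" | "z \<in> R21" | "z \<in> R22" using assms(2) by blast
  then show ?thesis
  proof cases
    case 1
    then show ?thesis using c by (intro R11_faithful) (auto simp: mult_zero)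
  next
    case 4
    then show ?thesis using c by (intro R22_faithful) (auto simp: mult_zero simp flip: c)
  qed (use c[of e] in \<open>simp_all add: peirce_eigen\<close>)
qed

end

section \<open>Additivity modulo the centre\<close>

locale normalised_lie_derivation = faithful_peirce_pair +
  fixes D :: "'a \<Rightarrow> 'a"
  assumes lie: "lie_multiplicative_derivation D" and D_e_diagonal: "commutator (D e) e = 0"
begin

lemma D_commutator: "D (commutator x y) = commutator (D x) y + commutator x (D y)"
  using lie by (simp add: lie_multiplicative_derivation_def)

lemma D_0: "D 0 = 0"
  using D_commutator[of 0 0] by simp

text \<open>Applying \<open>D\<close> to [f,e] = 0 turns diagonality of \<open>D e\<close> into that
  of \<open>D f\<close>.\<close>

lemma normalised_swap: "normalised_lie_derivation f e D"
proof -
  interpret s: faithful_peirce_pair f e by (rule faithful_swap)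
  have "commutator f e = 0" using f_mem by (rule commutator_e)
  then have "commutator (D f) e + commutator f (D e) = 0"
    using D_commutator[of f e] D_0 by simp
  then have "commutator (D f) f = 0"
    using commutator_f[of "D f"] commutator_f[of "D e"] commutator_swap[of f "D e"] D_e_diagonal
    by simp
  then show ?thesis by unfold_locales (simp_all add: lie)
qed

text \<open>Apply \<open>D\<close> to [e,x] = x and compare components: the commutator with
  \<open>e\<close> on the left acts as 1 on \<open>R12\<close>, as -1 on \<open>R21\<close> and as 0
  on the diagonal.\<close>

lemma D_R12_aux:
  assumes x: "x \<in> R12"
  shows "D x \<in> R12" and "commutator (D e) x = 0"
proof -
  let ?r = "commutator (D e) x"
  have r: "?r \<in> R12" using commutator_mem(2)[OF D_e_diagonal x] .
  obtain d11 d12 d21 d22 where d: "d11 \<in> R11" "d12 \<in> R12" "d21 \<in> R21" "d22 \<in> R22"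
    "D x = d11 + d12 + d21 + d22" by (rule decomposeE)
  have ex: "commutator e x = x" using commutator_e(2)[OF x] commutator_swap[of e x] by simp
  have "D x = ?r + commutator e (D x)" using D_commutator[of e x] ex by simp
  also have "commutator e (D x) = d12 - d21"
    using d by (simp add: commutator_swap[of e] commutator_linear commutator_e)
  finally have "d11 + (- ?r) + (d21 + d21) + d22 = 0"
    by (simp add: d(5) algebra_simps)
  from sum_zero[OF this] r d have z: "d11 = 0" "- ?r = 0" "d21 + d21 = 0" "d22 = 0"
    by (simp_all add: Rij_subgroup)
  with two_torsion_free[OF z(3)] d show "D x \<in> R12" "?r = 0" by simp_all
qed

lemma D_R12: "x \<in> R12 \<Longrightarrow> D x \<in> R12"
  by (rule D_R12_aux)

lemma D_R21: "x \<in> R21 \<Longrightarrow> D x \<in> R21"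
  using normalised_lie_derivation.D_R12[OF normalised_swap] .

lemma D_e_centre: "D e \<in> centre"
  using D_e_diagonal D_R12_aux(2) by (rule centre_if_commutes_R12)

lemma D_f_centre: "D f \<in> centre"
  using normalised_lie_derivation.D_e_centre[OF normalised_swap] .

lemma D_diagonal: "commutator (D x) e = 0" if "commutator x e = 0"
  using D_commutator[of x e] D_0 that centre_commutator(2)[OF D_e_centre] by simp

definition defect :: "'a \<Rightarrow> 'a \<Rightarrow> 'a" where
  "defect x y = D (x + y) - D x - D y"

lemma defect_0 [simp]: "defect 0 x = 0" "defect x 0 = 0"
  by (simp_all add: defect_def D_0)

text \<open>The terms in which \<open>D\<close> acts on \<open>t\<close> cancel, so taking commutators with \<open>t\<close> commutes
  with the defect of additivity.\<close>

lemma commutator_defect: "commutator (defect x y) t = defect (commutator x t) (commutator y t)"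
proof -
  have "D (commutator (x + y) t) - D (commutator x t) - D (commutator y t) =
      commutator (defect x y) t"
    unfolding D_commutator by (simp add: defect_def commutator_linear)
  then show ?thesis by (simp add: defect_def commutator_linear)
qed

lemma defect_R12_R21_mem:
  assumes u: "u \<in> R12" and v: "v \<in> R21"
  shows "defect u v \<in> R12"
proof -
  \<comment> \<open>The double commutator with \<open>e\<close> fixes \<open>u\<close> and
    \<open>v\<close>, hence also their defect, which is therefore off-diagonal.\<close>
  have uv: "commutator (commutator u e) e = u" "commutator (commutator v e) e = v"
    using commutator_e(2)[OF u] commutator_e(3)[OF v] by (simp_all add: commutator_linear)
  obtain p q where pq: "p \<in> R12" "q \<in> R21" "commutator (commutator (defect u v) e) e = p + q"
    by (rule commutator_e_offdiag)
  then have w: "defect u v = p + q" by (simp add: commutator_defect uv)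
  \<comment> \<open>Since [v,y] is diagonal, a further commutator with \<open>e\<close> makes one
    argument of the defect zero; it also kills the diagonal [q,y] but fixes [p,y] in
    \<open>R21\<close>.\<close>
  have py: "commutator p y = 0" if y: "y \<in> R12" for y
  proof -
    have "commutator (commutator (defect u v) y) e = 0"
      using commutator_mem(3)[OF v y] by (simp add: commutator_defect)
    then show ?thesis
      using commutator_mem(3)[OF pq(2) y] commutator_e(3)[OF commutator_mem(1)[OF pq(1) y]]
      by (simp add: w commutator_linear)
  qed
  \<comment> \<open>With one more commutator by \<open>z\<close>, the argument coming from
    \<open>u\<close> becomes diagonal, so the commutator with \<open>e\<close> again gives
    zero.\<close>
  have qy: "commutator q y \<in> centre" if y: "y \<in> R12" for y
  proof (rule centre_if_commutes_R12)
    show diag: "commutator (commutator q y) e = 0" by (rule commutator_mem(3)[OF pq(2) y])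
    fix z assume z: "z \<in> R12"
    have "commutator (commutator (commutator (defect u v) y) z) e = 0"
      using commutator_mem(3)[OF commutator_mem(1)[OF u y] z] by (simp add: commutator_defect)
    then have "commutator (commutator (commutator q y) z) e = 0"
      by (simp add: w commutator_linear py[OF y])
    then show "commutator (commutator q y) z = 0"
      using commutator_e(2)[OF commutator_mem(2)[OF diag z]] by simp
  qed
  have "q * y = 0" if y: "y \<in> R12" for y
  proof -
    let ?c = "commutator q y"
    \<comment> \<open>As the square of \<open>y\<close> is zero, \<open>?c\<close> anticommutes with
      \<open>y\<close>; being central it also commutes, so \<open>?c * y = 0\<close>. Then
      \<open>?c = 0\<close>, or \<open>y = 0\<close> and again \<open>?c = 0\<close>.\<close>
    have yy: "y * y = 0" using y by (rule square_zero)
    have "?c * y = - (y * q * y)" "y * ?c = y * q * y"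
      using left_alternative_mult[of y q] right_alternative_mult[of q y] flexible[of y q]
      by (simp_all add: commutator_def nonassoc_simps yy)
    then have "?c * y + ?c * y = 0"
      using centre_comm[OF qy[OF y], of y] by (metis add.right_inverse)
    then have "?c * y = 0" by (rule two_torsion_free)
    then have "?c = 0" using centre_cancel[OF qy[OF y]] by fastforce
    then have "- (y * q) + 0 + 0 + q * y = 0" by (simp add: commutator_def)
    from sum_zero(4)[OF this] show ?thesis
      using mult_mem(4)[OF y pq(2)] mult_mem(7)[OF pq(2) y] by (simp add: Rij_subgroup)
  qed
  then have "q = 0" using R21_faithful pq(2) by blast
  then show ?thesis using pq(1) w by simp
qed

text \<open>By symmetry the defect lies in both \<open>R12\<close> and \<open>R21\<close>.\<close>

lemma defect_R12_R21: "defect u v = 0" if "u \<in> R12" "v \<in> R21"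
proof -
  interpret s: normalised_lie_derivation f e D by (rule normalised_swap)
  have "defect u v = s.defect v u"
    by (simp add: defect_def s.defect_def algebra_simps)
  then have "defect u v \<in> R12" "defect u v \<in> R21"
    using defect_R12_R21_mem[OF that] s.defect_R12_R21_mem[OF that(2,1)] by simp_all
  then show ?thesis by (simp add: mem_peirce)
qed

lemma D_add_R12:
  assumes x: "x \<in> R12" and y: "y \<in> R12"
  shows "D (x + y) = D x + D y"
proof -
  \<comment> \<open>A commutator with \<open>e\<close> makes the first argument zero; one with
    \<open>z\<close> moves the arguments to \<open>R12\<close> and \<open>R21\<close>, where the
    defect vanishes.\<close>
  have central: "defect a x \<in> centre" if x: "x \<in> R12" and a: "commutator a e = 0" for a x
  proof (rule centre_if_commutes_R12)
    show "commutator (defect a x) e = 0" by (simp add: commutator_defect a)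
    show "commutator (defect a x) z = 0" if "z \<in> R12" for z
      using commutator_mem(2)[OF a that] commutator_mem(1)[OF x that]
      by (simp add: commutator_defect defect_R12_R21)
  qed
  have ef: "commutator e e = 0" "commutator f e = 0"
    using commutator_e f_mem by simp_all
  define r where "r = D e + defect e x"
  define s where "s = D f + defect f y"
  have r: "r \<in> centre" "D (e + x) = r + D x"
    using centre_add[OF D_e_centre central[OF x ef(1)]] by (simp_all add: r_def defect_def)
  have s: "s \<in> centre" "D (f + y) = s + D y"
    using centre_add[OF D_f_centre central[OF y ef(2)]] by (simp_all add: s_def defect_def)
  \<comment> \<open>This writes a sum as a single commutator, to which the Lie rule applies; the
    central terms \<open>r\<close> and \<open>s\<close> then drop out.\<close>
  have sum: "commutator (e + x') (f + y') = x' + y' + commutator x' y'"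
    if "x' \<in> R12" "y' \<in> R12" for x' y'
    using that ef(2) commutator_swap[of e f] commutator_swap[of e y'] commutator_e(2) commutator_f[of x']
    by (simp add: commutator_linear algebra_simps)
  have "D (x + y) + D (commutator x y) = D (x + y + commutator x y)"
    using defect_R12_R21[OF R12_subgroup(2)[OF x y] commutator_mem(1)[OF x y]]
    by (simp add: defect_def algebra_simps)
  also have "\<dots> = commutator (D (e + x)) (f + y) + commutator (e + x) (D (f + y))"
    using D_commutator sum[OF x y] by metis
  also have "\<dots> = commutator (D x) (f + y) + commutator (e + x) (D y)"
    by (simp add: r s commutator_linear centre_commutator)
  also have "\<dots> = D x + D y + D (commutator x y)"
    using commutator_f[of "D x"] commutator_e(2)[OF D_R12[OF x]] commutator_e(2)[OF D_R12[OF y]]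
      commutator_swap[of e "D y"]
    by (simp add: D_commutator commutator_linear algebra_simps)
  finally show ?thesis by simp
qed

lemma D_add_R21: "x \<in> R21 \<Longrightarrow> y \<in> R21 \<Longrightarrow> D (x + y) = D x + D y"
  using normalised_lie_derivation.D_add_R12[OF normalised_swap] .

lemma defect_offdiagonal: "defect (commutator x e) (commutator y e) = 0"
proof -
  obtain u v where uv: "u \<in> R12" "v \<in> R21" "commutator x e = u + v" by (rule commutator_e_offdiag)
  obtain u' v' where uv': "u' \<in> R12" "v' \<in> R21" "commutator y e = u' + v'"
    by (rule commutator_e_offdiag)
  have split: "D (a + b) = D a + D b" if "a \<in> R12" "b \<in> R21" for a b
    using defect_R12_R21[OF that] by (simp add: defect_def algebra_simps)
  have "D ((u + u') + (v + v')) = (D u + D v) + (D u' + D v')"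
    using uv uv' by (simp add: split D_add_R12 D_add_R21 Rij_subgroup)
  then show ?thesis
    using uv uv' by (simp add: defect_def split algebra_simps)
qed

text \<open>Commutators with \<open>e\<close> move the arguments off the diagonal, where
  \<open>D\<close> is additive. So the defect is diagonal, and [defect,z] lies in \<open>R12\<close>
  but is killed by the commutator with \<open>e\<close>, which acts there as -1.\<close>

lemma defect_centre: "defect x y \<in> centre"
proof (rule centre_if_commutes_R12)
  show diag: "commutator (defect x y) e = 0"
    by (simp add: commutator_defect defect_offdiagonal)
  fix z assume z: "z \<in> R12"
  have "commutator (commutator (defect x y) z) e = 0"
    by (simp add: commutator_defect defect_offdiagonal)
  then show "commutator (defect x y) z = 0"
    using commutator_e(2)[OF commutator_mem(2)[OF diag z]] by simp
qed

end

section \<open>Graded Lie derivations modulo the centre\<close>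

text \<open>Models \<open>D\<close> after its central correction. A central deviation lying in one
  Peirce component must vanish, which upgrades the Lie rule to the product rule.\<close>

locale graded_lie_map = faithful_peirce_pair +
  fixes \<delta> :: "'a \<Rightarrow> 'a"
  assumes add: "\<And>x y. \<delta> (x + y) = \<delta> x + \<delta> y"
    and graded: "\<And>a b x. a \<in> {e, f} \<Longrightarrow> b \<in> {e, f} \<Longrightarrow> x \<in> peirce a b \<Longrightarrow> \<delta> x \<in> peirce a b"
    and lie_mod_centre:
      "\<And>x y. \<delta> (commutator x y) - (commutator (\<delta> x) y + commutator x (\<delta> y)) \<in> centre"
begin

lemma graded_swap: "graded_lie_map f e \<delta>"
proof -
  interpret s: faithful_peirce_pair f e by (rule faithful_swap)
  show ?thesis by unfold_locales (use graded in \<open>auto simp: add lie_mod_centre\<close>)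
qed

lemma graded_Rij:
  "x \<in> R11 \<Longrightarrow> \<delta> x \<in> R11" "x \<in> R12 \<Longrightarrow> \<delta> x \<in> R12" "x \<in> R21 \<Longrightarrow> \<delta> x \<in> R21" "x \<in> R22 \<Longrightarrow> \<delta> x \<in> R22"
  by (simp_all add: graded)

lemma delta_0: "\<delta> 0 = 0"
  using add[of 0 0] by simp

lemma delta_minus: "\<delta> (- x) = - \<delta> x"
  using add[of "- x" x] delta_0 by (simp add: eq_neg_iff_add_eq_0)

lemma delta_diff: "\<delta> (x - y) = \<delta> x - \<delta> y"
  using add[of x "- y"] delta_minus by simp

lemma product_zero:
  "x \<in> R11 \<Longrightarrow> y \<in> R21 \<Longrightarrow> \<delta> (x * y) = \<delta> x * y + x * \<delta> y"
  "x \<in> R11 \<Longrightarrow> y \<in> R22 \<Longrightarrow> \<delta> (x * y) = \<delta> x * y + x * \<delta> y"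
  "x \<in> R12 \<Longrightarrow> y \<in> R11 \<Longrightarrow> \<delta> (x * y) = \<delta> x * y + x * \<delta> y"
  by (simp_all add: mult_zero graded_Rij delta_0)

text \<open>The reversed products vanish, so the commutators are plain products and the central
  deviation lies in \<open>R12\<close>. The same holds for \<open>product_R12_R22\<close>.\<close>

lemma product_R11_R12: "\<delta> (x * y) = \<delta> x * y + x * \<delta> y" if "x \<in> R11" "y \<in> R12"
proof -
  have "\<delta> (x * y) - (\<delta> x * y + x * \<delta> y) = 0"
    using that lie_mod_centre[of x y]
    by (intro centre_inter_peirce)
      (simp_all add: commutator_def mult_zero graded_Rij mult_mem R12_subgroup)
  then show ?thesis by simp
qed

lemma product_R12_R22: "\<delta> (x * y) = \<delta> x * y + x * \<delta> y" if "x \<in> R12" "y \<in> R22"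
proof -
  have "\<delta> (x * y) - (\<delta> x * y + x * \<delta> y) = 0"
    using that lie_mod_centre[of x y]
    by (intro centre_inter_peirce)
      (simp_all add: commutator_def mult_zero graded_Rij mult_mem R12_subgroup)
  then show ?thesis by simp
qed

text \<open>Elements of \<open>R12\<close> anticommute, so [x,y] is twice \<open>x * y\<close> and
  twice the deviation is central in \<open>R21\<close>.\<close>

lemma product_R12_R12: "\<delta> (x * y) = \<delta> x * y + x * \<delta> y" if "x \<in> R12" "y \<in> R12"
proof -
  let ?c = "\<delta> (x * y) - (\<delta> x * y + x * \<delta> y)"
  have "?c + ?c \<in> centre"
    using lie_mod_centre[of x y] that
    by (simp add: commutator_def anticommute[of x y] anticommute[of "\<delta> x" y]
        anticommute[of x "\<delta> y"] graded_Rij add algebra_simps)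
  moreover have "?c + ?c \<in> R21"
    using that by (simp add: graded_Rij mult_mem R21_subgroup)
  ultimately have "?c + ?c = 0" by (intro centre_inter_peirce) auto
  then have "?c = 0" by (rule two_torsion_free)
  then show ?thesis by simp
qed

text \<open>Expanding \<delta> on both bracketings of \<open>x\<close>, \<open>y\<close>,
  \<open>z\<close> with \<open>z\<close> in \<open>R12\<close> shows that the deviation annihilates
  \<open>R12\<close>.\<close>

lemma product_R11_R11: "\<delta> (x * y) = \<delta> x * y + x * \<delta> y" if x: "x \<in> R11" and y: "y \<in> R11"
proof -
  have "(\<delta> (x * y) - (\<delta> x * y + x * \<delta> y)) * z = 0" if z: "z \<in> R12" for z
  proof -
    have "\<delta> (x * y) * z + (x * y) * \<delta> z = \<delta> ((x * y) * z)"
      using x y z by (simp add: product_R11_R12 mult_mem)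
    also have "\<dots> = \<delta> (x * (y * z))"
      using x y z by (simp add: peirce_assoc)
    also have "\<dots> = \<delta> x * (y * z) + x * (\<delta> y * z + y * \<delta> z)"
      using x y z by (simp add: product_R11_R12 mult_mem)
    finally show ?thesis
      using x y z by (simp add: nonassoc_simps peirce_assoc graded_Rij mult_mem algebra_simps)
  qed
  then have "\<delta> (x * y) - (\<delta> x * y + x * \<delta> y) = 0"
    using x y by (intro R11_faithful) (simp_all add: mult_mem graded_Rij R11_subgroup)
  then show ?thesis by simp
qed

text \<open>The deviations \<open>a\<close> and \<open>b\<close> on \<open>u v\<close> and \<open>v u\<close> differ by a central \<open>c\<close>; comparing
  \<open>\<delta> ((u v) u)\<close> with \<open>\<delta> (u (v u))\<close> gives \<open>a u = u b\<close>, that is \<open>2 c u = 0\<close>.\<close>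

lemma product_R12_R21_aux:
  assumes u: "u \<in> R12" and v: "v \<in> R21"
  shows "\<delta> (u * v) = \<delta> u * v + u * \<delta> v \<and> \<delta> (v * u) = \<delta> v * u + v * \<delta> u"
proof -
  define a where "a = \<delta> (u * v) - (\<delta> u * v + u * \<delta> v)"
  define b where "b = \<delta> (v * u) - (\<delta> v * u + v * \<delta> u)"
  define c where "c = a - b"
  have ab: "a \<in> R11" "b \<in> R22"
    using u v by (simp_all add: a_def b_def graded_Rij mult_mem Rij_subgroup)
  have c: "c \<in> centre"
    using lie_mod_centre[of u v]
    by (simp add: c_def a_def b_def commutator_def delta_diff algebra_simps)
  have a': "\<delta> (u * v) = a + (\<delta> u * v + u * \<delta> v)" and b': "\<delta> (v * u) = b + (\<delta> v * u + v * \<delta> u)"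
    by (simp_all add: a_def b_def)
  have "(a + (\<delta> u * v + u * \<delta> v)) * u + (u * v) * \<delta> u = \<delta> ((u * v) * u)"
    using u v by (simp add: product_R11_R12 mult_mem a')
  also have "\<dots> = \<delta> (u * (v * u))" by (simp add: flexible)
  also have "\<dots> = \<delta> u * (v * u) + u * (b + (\<delta> v * u + v * \<delta> u))"
    using u v by (simp add: product_R12_R22 mult_mem b')
  \<comment> \<open>The two associators are opposite by skew symmetry.\<close>
  finally have "a * u + associator (\<delta> u) v u + associator u v (\<delta> u) = u * b"
    by (simp add: associator_def nonassoc_simps flexible algebra_simps)
  then have au: "a * u = u * b"
    using associator_swap23[of "\<delta> u" v u] associator_rotate[of u v "\<delta> u"] by simp
  have "c * u = a * u" "u * c = - (u * b)"
    using ab u by (simp_all add: c_def nonassoc_simps mult_zero)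
  then have "c * u + c * u = 0" using au centre_comm[OF c, of u] by (metis add.right_inverse)
  then have "c * u = 0" by (rule two_torsion_free)
  \<comment> \<open>Invertibility of a nonzero \<open>c\<close> would force \<open>u = 0\<close>,
    where both deviations vanish anyway.\<close>
  moreover have "c = 0" if "u = 0"
    by (simp add: that c_def a_def b_def delta_0)
  ultimately have "c = 0" using centre_cancel[OF c] by blast
  then have "a + 0 + 0 + - b = 0" by (simp add: c_def)
  from sum_zero(1,4)[OF this] have "a = 0" "b = 0"
    using ab by (simp_all add: Rij_subgroup)
  then show ?thesis by (simp add: a_def b_def)
qed

text \<open>Of the sixteen component products, seven are treated directly, seven by exchanging
  \<open>e\<close> and \<open>f\<close>, and the last two by
  \<open>product_R12_R21_aux\<close>.\<close>

lemma additive_derivation_delta: "additive_derivation \<delta>"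
proof -
  interpret s: graded_lie_map f e \<delta> by (rule graded_swap)
  note products = product_zero product_R11_R12 product_R12_R22 product_R12_R12 product_R11_R11
    s.product_zero s.product_R11_R12 s.product_R12_R22 s.product_R12_R12 s.product_R11_R11
    product_R12_R21_aux[THEN conjunct1] product_R12_R21_aux[THEN conjunct2]
  have "\<delta> (x * y) = \<delta> x * y + x * \<delta> y" for x y
  proof -
    obtain x11 x12 x21 x22 where x: "x11 \<in> R11" "x12 \<in> R12" "x21 \<in> R21" "x22 \<in> R22"
      "x = x11 + x12 + x21 + x22" by (rule decomposeE)
    obtain y11 y12 y21 y22 where y: "y11 \<in> R11" "y12 \<in> R12" "y21 \<in> R21" "y22 \<in> R22"
      "y = y11 + y12 + y21 + y22" by (rule decomposeE)
    show ?thesis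
      unfolding x(5) y(5) nonassoc_simps add
      using x y by (simp add: products algebra_simps)
  qed
  then show ?thesis by (simp add: additive_derivation_def add)
qed

end

section \<open>Central correction to a graded additive map\<close>

context normalised_lie_derivation
begin

text \<open>The centre meets a Peirce component only in 0, so the chosen representatives are unique;
  since defects of \<open>D\<close> are central, the choice is additive.\<close>

lemma peirce_lift:
  assumes ab: "a \<in> {e, f}" "b \<in> {e, f}"
    and ex: "\<And>x. x \<in> peirce a b \<Longrightarrow> \<exists>d \<in> peirce a b. D x - d \<in> centre"
  shows "\<exists>g. (\<forall>x \<in> peirce a b. g x \<in> peirce a b \<and> D x - g x \<in> centre) \<and>
    (\<forall>x \<in> peirce a b. \<forall>y \<in> peirce a b. g (x + y) = g x + g y) \<and> g 0 = 0"
proof -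
  note sub = peirce_subgroup[OF ab]
  obtain g where g: "\<And>x. x \<in> peirce a b \<Longrightarrow> g x \<in> peirce a b \<and> D x - g x \<in> centre"
    using ex by metis
  have g_add: "g (x + y) = g x + g y" if "x \<in> peirce a b" "y \<in> peirce a b" for x y
  proof -
    have "defect x y - (D (x + y) - g (x + y)) + (D x - g x) + (D y - g y) \<in> centre"
      using centre_add[OF centre_add[OF centre_diff[OF defect_centre g[THEN conjunct2]]
            g[THEN conjunct2]] g[THEN conjunct2], OF sub(2)[OF that] that] .
    then have "g (x + y) - (g x + g y) \<in> centre" by (simp add: defect_def algebra_simps)
    moreover have "g (x + y) - (g x + g y) \<in> peirce a b" using that g sub by simp
    ultimately have "g (x + y) - (g x + g y) = 0"
      using ab by (intro centre_inter_peirce) auto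
    then show ?thesis by simp
  qed
  moreover have "g 0 = 0" using g_add[OF sub(1) sub(1)] by simp
  ultimately show ?thesis using g by blast
qed

text \<open>Condition a) makes the \<open>R22\<close>-part of \<open>D x\<close> equal to
  \<open>z * f\<close>, so subtracting \<open>z\<close> itself leaves an element of
  \<open>R11\<close>.\<close>

lemma lift_R11:
  assumes "\<And>x. x \<in> R11 \<Longrightarrow> \<exists>z \<in> centre. (f * D x) * f = z * f" and x: "x \<in> R11"
  shows "\<exists>d \<in> R11. D x - d \<in> centre"
proof -
  obtain z where z: "z \<in> centre" "(f * D x) * f = z * f" using assms by blast
  obtain d1 d2 where d: "d1 \<in> R11" "d2 \<in> R22" "D x = d1 + d2"
    by (rule diagonalE[OF D_diagonal[OF commutator_e(1)[OF x]]])
  have "d2 = z * f" using z(2) d by (simp add: nonassoc_simps peirce_eigen)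
  then have "D x - z = d1 - z * e" using d(3) by (simp add: f_mult algebra_simps)
  moreover have "z * e \<in> R11"
    using centre_comm[OF z(1), of e] by (simp add: mem_R11 flip: centre_assoc(2)[OF z(1)])
      (simp add: centre_assoc[OF z(1)] idem)
  ultimately have "D x - z \<in> R11" using d(1) by (simp add: R11_subgroup)
  then show ?thesis using z(1) by (intro bexI[of _ "D x - z"]) auto
qed

lemma decompose_D:
  assumes a: "\<And>x. x \<in> R11 \<Longrightarrow> \<exists>z \<in> centre. (f * D x) * f = z * f"
    and b: "\<And>x. x \<in> R22 \<Longrightarrow> \<exists>z \<in> centre. (e * D x) * e = z * e"
  shows "\<exists>\<delta>. additive_derivation \<delta> \<and> (\<forall>x. D x - \<delta> x \<in> centre)"
proof -
  interpret s: normalised_lie_derivation f e D by (rule normalised_swap)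
  have ef: "e \<in> {e, f}" "f \<in> {e, f}" by simp_all
  obtain g11 where g11: "\<And>x. x \<in> R11 \<Longrightarrow> g11 x \<in> R11" "\<And>x. x \<in> R11 \<Longrightarrow> D x - g11 x \<in> centre"
    "\<And>x y. x \<in> R11 \<Longrightarrow> y \<in> R11 \<Longrightarrow> g11 (x + y) = g11 x + g11 y" "g11 0 = 0"
    using peirce_lift[OF ef(1,1) lift_R11[OF a]] by blast
  obtain g22 where g22: "\<And>x. x \<in> R22 \<Longrightarrow> g22 x \<in> R22" "\<And>x. x \<in> R22 \<Longrightarrow> D x - g22 x \<in> centre"
    "\<And>x y. x \<in> R22 \<Longrightarrow> y \<in> R22 \<Longrightarrow> g22 (x + y) = g22 x + g22 y" "g22 0 = 0"
    using peirce_lift[OF ef(2,2) s.lift_R11[OF b]] by blast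
  define \<delta> where "\<delta> x = g11 ((e * x) * e) + D ((e * x) * f) + D ((f * x) * e) + g22 ((f * x) * f)"
    for x
  note mem = component_mem[of e _ e] component_mem[of e _ f] component_mem[of f _ e]
    component_mem[of f _ f]
  have central: "D x - \<delta> x \<in> centre" for x
  proof -
    let ?p = "(e * x) * e" and ?q = "(e * x) * f" and ?r = "(f * x) * e" and ?s = "(f * x) * f"
    \<comment> \<open>The three defects telescope to the deviation of \<open>D\<close> from
      additivity over the four components.\<close>
    have "defect (?p + ?q + ?r) ?s + defect (?p + ?q) ?r + defect ?p ?q
        + (D ?p - g11 ?p) + (D ?s - g22 ?s) \<in> centre"
      by (intro centre_add defect_centre g11 g22 mem)
    then have "D (?p + ?q + ?r + ?s) - \<delta> x \<in> centre"
      by (simp add: defect_def \<delta>_def algebra_simps)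
    then show ?thesis using decompose[of x] by simp
  qed
  have add: "\<delta> (x + y) = \<delta> x + \<delta> y" for x y
    by (simp add: \<delta>_def nonassoc_simps g11 g22 D_add_R12 D_add_R21 mem algebra_simps)
  have "graded_lie_map e f \<delta>"
  proof
    show "\<delta> (x + y) = \<delta> x + \<delta> y" for x y by (rule add)
    show "\<delta> x \<in> peirce a b" if ab: "a \<in> {e, f}" "b \<in> {e, f}" and x: "x \<in> peirce a b" for a b x
      using ab x by (auto simp: \<delta>_def peirce_eigen g11 g22 D_0 D_R12 D_R21)
    fix x y
    \<comment> \<open>Since \<open>D\<close> satisfies the Lie rule exactly, only its central
      differences from \<delta> remain.\<close>
    have "\<delta> (commutator x y) - (commutator (\<delta> x) y + commutator x (\<delta> y)) =
      commutator (D x - \<delta> x) y + commutator x (D y - \<delta> y) - (D (commutator x y) - \<delta> (commutator x y))"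
      unfolding D_commutator by (simp add: commutator_linear)
    also have "\<dots> \<in> centre"
      using centre_diff[OF centre_0 central] by (simp add: centre_commutator central)
    finally show "\<delta> (commutator x y) - (commutator (\<delta> x) y + commutator x (\<delta> y)) \<in> centre" .
  qed
  then show ?thesis using graded_lie_map.additive_derivation_delta central by blast
qed

end

section \<open>Derivations on diagonal corners and the equivalence\<close>

lemma additive_derivation_commutator:
  assumes "additive_derivation \<delta>"
  shows "\<delta> (commutator x y) = commutator (\<delta> x) y + commutator x (\<delta> y)"
proof -
  have "\<delta> (x * y - y * x) = \<delta> (x * y) - \<delta> (y * x)"
    using assms unfolding additive_derivation_def by (metis add_diff_cancel diff_add_cancel)
  then show ?thesis
    using assms by (simp add: additive_derivation_def commutator_expand)
qed

text \<open>Differentiate \<open>x = e * x\<close>: left multiplication by \<open>f\<close> kills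
  \<open>e * \<delta> x\<close>, and \<open>\<delta> e * x\<close> lies in \<open>R11\<close> +
  \<open>R21\<close>, which \<open>f\<close> kills from the right.\<close>

lemma (in peirce_pair) additive_derivation_R11:
  assumes \<delta>: "additive_derivation \<delta>" and x: "x \<in> R11"
  shows "(f * \<delta> x) * f = 0"
proof -
  have mult: "\<delta> (x * y) = \<delta> x * y + x * \<delta> y" for x y
    using \<delta> by (simp add: additive_derivation_def)
  obtain d11 d12 d21 d22 where d: "d11 \<in> R11" "d12 \<in> R12" "d21 \<in> R21" "d22 \<in> R22"
    "\<delta> e = d11 + d12 + d21 + d22" by (rule decomposeE)
  have "\<delta> x = \<delta> e * x + e * \<delta> x" using mult[of e x] x by (simp add: peirce_eigen)
  then have "f * \<delta> x * f = f * (\<delta> e * x) * f + f * (e * \<delta> x) * f"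
    by (metis nonassoc_simps(1,2))
  also have "f * (e * \<delta> x) * f = 0" by (simp add: f_mult)
  also have "f * (\<delta> e * x) * f = 0"
    using d x mult_mem(1)[of d11 x] mult_mem(6)[of d21 x]
    by (simp add: nonassoc_simps mult_zero peirce_eigen)
  finally show ?thesis by simp
qed

theorem theorem2p1:
  fixes e1 e2 :: "'a::unital_alternative_ring" and D :: "'a \<Rightarrow> 'a"
  assumes "torsion_free 2 TYPE('a)" and "torsion_free 3 TYPE('a)"
    and "nontrivial_idempotent e1" and "e2 = 1 - e1"
    and "\<And>x. x \<in> peirce e1 e2 \<Longrightarrow> (\<forall>y \<in> peirce e2 e1. x * y = 0) \<Longrightarrow> x = 0"
    and "\<And>x. x \<in> peirce e2 e1 \<Longrightarrow> (\<forall>y \<in> peirce e1 e2. x * y = 0) \<Longrightarrow> x = 0"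
    and "\<And>x. x \<in> peirce e1 e1 \<Longrightarrow>
           (\<forall>y \<in> peirce e1 e2. x * y = 0) \<or> (\<forall>y \<in> peirce e2 e1. y * x = 0) \<Longrightarrow> x = 0"
    and "\<And>x. x \<in> peirce e2 e2 \<Longrightarrow>
           (\<forall>y \<in> peirce e1 e2. y * x = 0) \<or> (\<forall>y \<in> peirce e2 e1. x * y = 0) \<Longrightarrow> x = 0"
    and "\<And>z::'a. z \<in> centre \<Longrightarrow> z \<noteq> 0 \<Longrightarrow> range (\<lambda>x. z * x) = UNIV"
    and "lie_multiplicative_derivation D"
  shows "(\<exists>\<delta> \<tau>. additive_derivation \<delta> \<and> (\<forall>x. \<tau> x \<in> centre) \<and>
             (\<forall>x y. \<tau> (commutator x y) = 0) \<and> (\<forall>x. D x = \<delta> x + \<tau> x)) \<longleftrightarrow>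
         (\<lambda>x. (e2 * D x) * e2) ` peirce e1 e1 \<subseteq> (\<lambda>z. z * e2) ` centre \<and>
         (\<lambda>x. (e1 * D x) * e1) ` peirce e2 e2 \<subseteq> (\<lambda>z. z * e1) ` centre"
    (is "?decomp \<longleftrightarrow> ?A \<and> ?B")
proof -
  interpret faithful_peirce_pair e1 e2
  proof
    show "x = 0" if "x + x = 0" for x :: 'a
      using assms(1)[unfolded torsion_free_def, rule_format, of x] that
      by (simp add: numeral_2_eq_2)
    show "x = 0" if "x + x + x = 0" for x :: 'a
      using assms(2)[unfolded torsion_free_def, rule_format, of x] that
      by (simp add: numeral_3_eq_3 add.assoc)
    show "e1 * e1 = e1" using assms(3) by (simp add: nontrivial_idempotent_def)
    show "e1 + e2 = 1" using assms(4) by simp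
  qed (fact assms)+
  interpret s: peirce_pair e2 e1 by (rule swap)
  show ?thesis
  proof
    assume ?decomp
    then obtain \<delta> \<tau> where \<delta>: "additive_derivation \<delta>" and \<tau>: "\<And>x. \<tau> x \<in> centre"
      and D: "\<And>x. D x = \<delta> x + \<tau> x" by blast
    have centre_idem: "(g * z) * g = z * g" if "z \<in> centre" "g * g = g" for g z :: 'a
      using that by (metis centre_comm centre_assoc(1))
    \<comment> \<open>The derivation contributes nothing to this corner, so \<open>\<tau> x\<close>
      is the required central element.\<close>
    have "(e2 * D x) * e2 = \<tau> x * e2" if "x \<in> R11" for x
      using additive_derivation_R11[OF \<delta> that] centre_idem[OF \<tau> s.idem]
      by (simp add: D nonassoc_simps)
    moreover have "(e1 * D x) * e1 = \<tau> x * e1" if "x \<in> R22" for x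
      using s.additive_derivation_R11[OF \<delta> that] centre_idem[OF \<tau> idem]
      by (simp add: D nonassoc_simps)
    ultimately show "?A \<and> ?B" using \<tau> by auto
  next
    assume AB: "?A \<and> ?B"
    \<comment> \<open>The double commutator with \<open>e1\<close> projects onto the off-diagonal
      part, so \<open>y\<close> is that part of \<open>D e1\<close>; the sign in \<open>- y\<close>
      makes \<open>\<Delta> e1 = y\<close>.\<close>
    define y where "y = commutator e1 (commutator e1 (D e1))"
    define \<Delta> where "\<Delta> = inner_derivation e1 (- y)"
    have \<Delta>: "additive_derivation \<Delta>" unfolding \<Delta>_def by (rule additive_derivation_inner)
    define D' where "D' x = D x - \<Delta> x" for x
    interpret N: normalised_lie_derivation e1 e2 D'
    proof
      show "lie_multiplicative_derivation D'"
        using assms(10) additive_derivation_commutator[OF \<Delta>]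
        by (simp add: lie_multiplicative_derivation_def D'_def commutator_linear)
      obtain u v where uv: "u \<in> R12" "v \<in> R21" "commutator (D e1) e1 = u + v"
        by (rule commutator_e_offdiag)
      have flip: "commutator e1 x = - commutator x e1" for x by (rule commutator_swap)
      have "y = - u + v"
        using uv by (simp add: y_def flip commutator_linear commutator_e)
      moreover have "associator e1 t e1 = 0" for t by (simp add: associator_def flexible)
      ultimately have "\<Delta> e1 = - u + v"
        using uv by (simp add: \<Delta>_def inner_derivation_def flip commutator_linear commutator_e)
      then show "commutator (D' e1) e1 = 0"
        using uv by (simp add: D'_def commutator_linear commutator_e)
    qed
    obtain \<delta> where \<delta>: "additive_derivation \<delta>" "\<And>x. D' x - \<delta> x \<in> centre"
    proof -
      have "\<exists>\<delta>. additive_derivation \<delta> \<and> (\<forall>x. D' x - \<delta> x \<in> centre)"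
      proof (rule N.decompose_D)
        \<comment> \<open>Conditions a) and b) pass from \<open>D\<close> to \<open>D'\<close>
          because the derivation \<Delta> vanishes in these corners.\<close>
        show "\<exists>z \<in> centre. (e2 * D' x) * e2 = z * e2" if "x \<in> R11" for x
          using AB that additive_derivation_R11[OF \<Delta> that]
          by (fastforce simp: D'_def nonassoc_simps)
        show "\<exists>z \<in> centre. (e1 * D' x) * e1 = z * e1" if "x \<in> R22" for x
          using AB that s.additive_derivation_R11[OF \<Delta> that]
          by (fastforce simp: D'_def nonassoc_simps)
      qed
      then show ?thesis using that by blast
    qed
    define \<delta>' where "\<delta>' x = \<delta> x + \<Delta> x" for x
    define \<tau> where "\<tau> x = D x - \<delta>' x" for x
    have \<delta>': "additive_derivation \<delta>'"
      using \<delta>(1) \<Delta> by (simp add: additive_derivation_def \<delta>'_def nonassoc_simps algebra_simps)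
    have "\<tau> x = D' x - \<delta> x" for x by (simp add: \<tau>_def \<delta>'_def D'_def algebra_simps)
    then have \<tau>: "\<tau> x \<in> centre" for x using \<delta>(2) by simp
    \<comment> \<open>As a difference of two maps obeying the Lie rule, \<tau> obeys it too; central
      values make the right side zero.\<close>
    have "\<tau> (commutator x y) = commutator (\<tau> x) y + commutator x (\<tau> y)" for x y
      using assms(10) additive_derivation_commutator[OF \<delta>']
      by (simp add: \<tau>_def lie_multiplicative_derivation_def commutator_linear)
    then have "\<tau> (commutator x y) = 0" for x y by (simp add: centre_commutator \<tau>)
    moreover have "D x = \<delta>' x + \<tau> x" for x by (simp add: \<tau>_def)
    ultimately show ?decomp using \<delta>' \<tau> by blast
  qed
qed

end
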